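(* Let $g:\mathbb{R}\to[0,\infty)$ be the probability density (with respect to Lebesgue measure) of a real random variable $W^*$ (the noise in the log-target at a proposed new target value), assumed independent of that target value, and satisfying $\int_{-\infty}^{\infty} e^{w} g(w)\,dw = 1$. Let $W$ be a random variable independent of $W^*$ with density $e^{w}g(w)$, and set $B := W^*-W$. For $\ell>0$ define $$J_m(\ell)=2\ell^2\,\mathbb{E}\left[\Phi\left(\frac{B}{\ell}-\frac{\ell}{2}\right)\right],\qquad J_\infty(\ell)=2\ell^2\,\Phi\left(-\frac{\ell}{2}\right).$$ Let $\hat{\ell}_m$ and $\hat{\ell}_\infty\approx 2.38$ be the values of $\ell>0$ which maximise $J_m(\ell)$ and $J_\infty(\ell)$, respectively. Then: 1. $\hat{\ell}_m\ge \hat{\ell}_\infty$. 2. If $g$ is log-concave then $\hat{\ell}_m\le 2\sqrt{2}$. 3. For any two scalings $\ell_1$ and $\ell_2$, both in $[\hat{\ell}_\infty,2\sqrt{2}]$, $J_m(\ell_1)/J_m(\ell_2)>0.70$.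
   Context: $\Phi$ denotes the cumulative distribution function of the standard Gaussian distribution. $J_m$ is the limiting expected squared jumping distance, as a function of the scaling $\ell$, of a stationary pseudo-marginal random walk Metropolis algorithm in which the target $\pi(x)$ is replaced by an unbiased estimate $\pi(x)e^{W^*}$; the subscript $m$ merely labels the noise distribution $g$. $J_\infty$ is the corresponding function when there is no noise ($B=0$). Parts 1 and 3 do not assume log-concavity of $g$. *)

theory Defs
  imports "HOL-Probability.Probability"
begin

abbreviation Phi :: "real \<Rightarrow> real" where
  "Phi \<equiv> cdf std_normal_distribution"

text \<open>
  Limiting expected squared jumping distance of the stationary pseudo-marginal random walk
  Metropolis algorithm at scaling \<open>l\<close>, where \<open>B\<close> is the difference between the noise in the
  log-target at the proposed value and at the current value.
\<close>

definition esjd :: "'a measure \<Rightarrow> ('a \<Rightarrow> real) \<Rightarrow> real \<Rightarrow> real" where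
  "esjd M B l = 2 * l\<^sup>2 * prob_space.expectation M (\<lambda>\<omega>. Phi (B \<omega> / l - l / 2))"

definition esjd_noiseless :: "real \<Rightarrow> real" where
  "esjd_noiseless l = 2 * l\<^sup>2 * Phi (- l / 2)"

text \<open>
  For \<open>g \<ge> 0\<close>: concavity of \<open>log g\<close> as a function into \<open>[-\<infinity>, \<infinity>)\<close>, with \<open>log 0 = -\<infinity>\<close>.
  Since \<^const>\<open>ln\<close> is real-valued, the logarithm is restricted to the support;
  \<^const>\<open>concave_on\<close> includes convexity of its domain.
\<close>

definition log_concave :: "(real \<Rightarrow> real) \<Rightarrow> bool" where
  "log_concave g \<longleftrightarrow> concave_on {x. 0 < g x} (\<lambda>x. ln (g x))"

end

theory Submission
  imports Defs "HOL-Real_Asymp.Real_Asymp"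
begin

text \<open>
  Swapping \<open>W\<^sup>*\<close> and \<open>W\<close> shows \<open>E (f B) = E (exp B * f (- B))\<close>. Hence \<open>J\<^sub>m l\<close> is the expectation of
  \<open>exp (B / 2) * l\<^sup>2 * F l B\<close> with
  \<open>F l x = exp (- x / 2) * \<Phi> (x / l - l / 2) + exp (x / 2) * \<Phi> (- x / l - l / 2)\<close>, which is even in \<open>x\<close>.
  Here \<open>\<partial>F/\<partial>l = - q\<close> for a Gaussian \<open>q\<close>, and \<open>F / q\<close> is the sum of the Mills ratio at \<open>l / 2 \<plusminus> x / l\<close>.
  Convexity of the Mills ratio bounds \<open>F / q\<close> below by its value at \<open>x = 0\<close>, the noiseless case.
  Pointwise in \<open>x\<close>, therefore, \<open>l\<^sup>2 F\<close> increases up to the noiseless optimum, while \<open>F\<close> decreases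
  and \<open>l\<^sup>3 F\<close> increases up to \<open>2\<surd>2\<close>; this gives parts 1 and 3, the latter because the
  squared noiseless optimum exceeds \<open>0.7 * 8\<close>.

  For part 2, \<open>F = 4 F'' + 4 q / l\<close> (in \<open>x\<close>) gives a closed form for \<open>l\<^sup>2 \<integral>\<^sub>0\<^sup>a F\<close>, which is seen to
  decrease in \<open>l\<close> once \<open>l\<^sup>2 > 8\<close>. If \<open>g\<close> is log-concave then \<open>exp (x / 2)\<close> times the density of \<open>B\<close>
  is a mixture of the functions \<open>x \<mapsto> exp v * g (v + x / 2) * g (v - x / 2)\<close>, which are even and decreasing in \<open>\<bar>x\<bar>\<close>,
  so the second mean value theorem transfers the monotonicity from \<open>{0..a}\<close> to \<open>J\<^sub>m\<close>.
\<close>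

subsection \<open>The Gaussian tail and the Mills ratio\<close>

interpretation std_normal: real_distribution std_normal_distribution
  by (rule real_dist_normal_dist)

lemma continuous_on_std_normal_density: "continuous_on S std_normal_density"
  unfolding normal_density_def by (intro continuous_intros) auto

text \<open>On \<open>{x - 1..x + 1}\<close>, which has \<open>x\<close> in its interior,
  \<open>Phi\<close> is a constant plus an integral of the continuous density, so the fundamental
  theorem of calculus applies.\<close>

lemma DERIV_Phi: "(Phi has_real_derivative std_normal_density x) (at x)"
proof -
  have diff: "Phi y = Phi (x - 1) + integral {x - 1..y} std_normal_density" if "y \<in> {x - 1..x + 1}" for y
  proof (cases "y = x - 1")
    case False
    then have lt: "x - 1 < y" using that by auto
    have cont: "continuous_on {x - 1..y} std_normal_density"
      by (rule continuous_on_std_normal_density)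
    have int: "set_integrable lborel {x - 1..y} std_normal_density"
      by (rule borel_integrable_atLeastAtMost') (rule cont)
    have "emeasure std_normal_distribution {x - 1<..y} =
        (\<integral>\<^sup>+t. ennreal (indicator {x - 1..y} t * std_normal_density t) \<partial>lborel)"
    proof (subst emeasure_density)
      show "(\<integral>\<^sup>+t. ennreal (std_normal_density t) * indicator {x - 1<..y} t \<partial>lborel) =
          (\<integral>\<^sup>+t. ennreal (indicator {x - 1..y} t * std_normal_density t) \<partial>lborel)"
        using AE_lborel_singleton[of "x - 1"]
        by (intro nn_integral_cong_AE) (auto elim!: eventually_mono split: split_indicator)
    qed auto
    also have "\<dots> = ennreal (\<integral>t. indicator {x - 1..y} t * std_normal_density t \<partial>lborel)"
      using int by (intro nn_integral_eq_integral) (auto simp: set_integrable_def)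
    also have "(\<integral>t. indicator {x - 1..y} t * std_normal_density t \<partial>lborel) =
        integral {x - 1..y} std_normal_density"
      using set_borel_integral_eq_integral(2)[OF int] by (simp add: set_lebesgue_integral_def)
    finally have "measure std_normal_distribution {x - 1<..y} = integral {x - 1..y} std_normal_density"
      by (simp add: measure_def integral_nonneg integrable_continuous_real cont)
    then show ?thesis
      using std_normal.cdf_diff_eq[OF lt] by simp
  qed simp
  have "((\<lambda>y. integral {x - 1..y} std_normal_density) has_real_derivative std_normal_density x)
      (at x within {x - 1..x + 1})"
    by (rule integral_has_real_derivative) (auto intro: continuous_on_std_normal_density)
  then have "((\<lambda>y. Phi (x - 1) + integral {x - 1..y} std_normal_density) has_real_derivative
      std_normal_density x) (at x within {x - 1..x + 1})"
    by (auto intro!: derivative_eq_intros)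
  then have "(Phi has_real_derivative std_normal_density x) (at x within {x - 1..x + 1})"
    by (rule has_field_derivative_transform_within[OF _ zero_less_one])
       (simp, rule diff[symmetric])
  then show ?thesis
    by (subst (asm) at_within_interior) auto
qed

lemmas DERIV_Phi_compose [derivative_intros] = DERIV_Phi[THEN DERIV_chain2]

lemma DERIV_std_normal_density:
  "(std_normal_density has_real_derivative - x * std_normal_density x) (at x)"
  unfolding normal_density_def by (auto intro!: derivative_eq_intros simp: field_simps power2_eq_square)

lemmas DERIV_std_normal_density_compose [derivative_intros] =
  DERIV_std_normal_density[THEN DERIV_chain2]

lemma std_normal_density_minus [simp]: "std_normal_density (- x) = std_normal_density x"
  by (simp add: std_normal_density_def)

lemma std_normal_density_pos [simp]: "0 < std_normal_density x"
  by (simp add: normal_density_pos)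

lemma std_normal_density_neq0 [simp]: "std_normal_density x \<noteq> 0"
  using std_normal_density_pos[of x] by linarith

lemma std_normal_density_le_1: "std_normal_density x \<le> 1"
proof -
  have "1 \<le> sqrt (2 * pi)" using pi_gt3 by (simp add: real_le_rsqrt)
  moreover have "exp (- x\<^sup>2 / 2) \<le> 1" by simp
  ultimately have "exp (- x\<^sup>2 / 2) \<le> sqrt (2 * pi)" by linarith
  then show ?thesis unfolding std_normal_density_def by (simp add: divide_le_eq_1)
qed

lemma Phi_bounds: "0 \<le> Phi x" "Phi x \<le> 1"
  using std_normal.cdf_nonneg std_normal.cdf_bounded_prob by auto

lemma Phi_at_bot: "(Phi \<longlongrightarrow> 0) at_bot"
  by (rule std_normal.cdf_lim_at_bot)

lemma Phi_mono: "x \<le> y \<Longrightarrow> Phi x \<le> Phi y"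
  by (rule std_normal.cdf_nondecreasing)

lemma Phi_pos: "0 < Phi x"
proof -
  have "Phi (x - 1) < Phi x"
    by (rule DERIV_pos_imp_increasing[of "x - 1" x Phi])
       (auto intro!: exI[of _ "std_normal_density _"] DERIV_Phi)
  then show ?thesis using Phi_bounds(1)[of "x - 1"] by simp
qed

text \<open>The Mills ratio solves \<open>m' = y * m - 1\<close>, and \<open>r\<close> is a
  subsolution that vanishes at infinity. The difference \<open>h\<close> therefore decreases to 0
  and is nonnegative at \<open>x\<close>.\<close>

lemma Phi_tail_ge:
  assumes "\<And>y. y \<ge> x \<Longrightarrow> (r has_real_derivative r' y) (at y)"
    and "\<And>y. y \<ge> x \<Longrightarrow> y * r y - r' y \<le> 1"
    and lim: "(r \<longlongrightarrow> 0) at_top"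
  shows "std_normal_density x * r x \<le> Phi (- x)"
proof -
  define h where "h y = Phi (- y) - std_normal_density y * r y" for y
  have h': "(h has_real_derivative std_normal_density y * (y * r y - r' y - 1)) (at y)" if "y \<ge> x" for y
    unfolding h_def
    by (auto intro!: derivative_eq_intros assms(1)[OF that] simp: algebra_simps)
  have dec: "h y \<le> h x" if "y \<ge> x" for y
    by (rule DERIV_nonpos_imp_nonincreasing[OF that])
       (use h' assms(2) in \<open>force intro!: exI mult_nonneg_nonpos\<close>)
  have "((\<lambda>y. Phi (- y)) \<longlongrightarrow> 0) at_top"
    using Phi_at_bot by (rule filterlim_compose) (rule filterlim_uminus_at_bot_at_top)
  moreover have "((\<lambda>y. std_normal_density y * r y) \<longlongrightarrow> 0) at_top"
    by (rule Lim_null_comparison[OF _ tendsto_rabs_zero[OF lim]])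
       (auto intro!: always_eventually simp: abs_mult mult_left_le_one_le std_normal_density_le_1)
  ultimately have "(h \<longlongrightarrow> 0 - 0) at_top"
    unfolding h_def by (rule tendsto_diff)
  then have "0 \<le> h x"
    using dec by (intro tendsto_upperbound[of h "0" at_top]) (auto intro!: eventually_at_top_linorderI[of x])
  then show ?thesis by (simp add: h_def)
qed

lemma Phi_tail_le:
  assumes "0 < x"
  shows "Phi (- x) \<le> std_normal_density x / x"
proof -
  define h where "h y = Phi (- y) - std_normal_density y / y" for y
  have h': "(h has_real_derivative std_normal_density y / y\<^sup>2) (at y)" if "y \<ge> x" for y
    unfolding h_def using that assms
    by (auto intro!: derivative_eq_intros simp: field_simps power2_eq_square)
  have dec: "h x \<le> h y" if "y \<ge> x" for y
    by (rule DERIV_nonneg_imp_nondecreasing[OF that]) (use h' in force)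
  have "((\<lambda>y. Phi (- y)) \<longlongrightarrow> 0) at_top"
    using Phi_at_bot by (rule filterlim_compose) (rule filterlim_uminus_at_bot_at_top)
  moreover have "((\<lambda>y. std_normal_density y / y) \<longlongrightarrow> 0) at_top"
    unfolding normal_density_def by real_asymp
  ultimately have "(h \<longlongrightarrow> 0 - 0) at_top"
    unfolding h_def by (rule tendsto_diff)
  then have "h x \<le> 0"
    using dec by (intro tendsto_lowerbound[of h "0" at_top]) (auto intro!: eventually_at_top_linorderI[of x])
  then show ?thesis by (simp add: h_def)
qed

definition mills :: "real \<Rightarrow> real" where
  "mills x = Phi (- x) / std_normal_density x"

lemma mills_pos: "0 < mills x"
  by (simp add: mills_def Phi_pos)

lemma DERIV_mills: "(mills has_real_derivative x * mills x - 1) (at x)"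
  unfolding mills_def
  by (auto intro!: derivative_eq_intros simp: field_simps)

lemma mills_ge:
  assumes "\<And>y. y \<ge> x \<Longrightarrow> (r has_real_derivative r' y) (at y)"
    and "\<And>y. y \<ge> x \<Longrightarrow> y * r y - r' y \<le> 1"
    and "(r \<longlongrightarrow> 0) at_top"
  shows "r x \<le> mills x"
  using Phi_tail_ge[OF assms] by (simp add: mills_def pos_le_divide_eq mult.commute)

lemma mills_mult_le: "x * mills x \<le> 1"
proof (cases "0 < x")
  case True
  then show ?thesis
    using Phi_tail_le[OF True] by (simp add: mills_def field_simps)
next
  case False
  then show ?thesis
    using mills_pos[of x] by (smt (verit) mult_nonneg_nonneg mult_minus_left)
qed

text \<open>The residual of the candidate in the Mills equation is \<open>2 / (1 + y^2)^2\<close>.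
  The bound is exactly what makes the second derivative of \<open>mills\<close> nonnegative in
  \<open>convex_mills\<close>.\<close>

lemma mills_ge_rational: "x / (1 + x\<^sup>2) \<le> mills x"
proof (rule mills_ge)
  fix y :: real
  have pos: "0 < 1 + y\<^sup>2" by (simp add: add_pos_nonneg)
  show "((\<lambda>y. y / (1 + y\<^sup>2)) has_real_derivative (1 - y\<^sup>2) / (1 + y\<^sup>2)\<^sup>2) (at y)"
    using pos by (auto intro!: derivative_eq_intros simp: field_simps power2_eq_square)
  have "y * (y / (1 + y\<^sup>2)) - (1 - y\<^sup>2) / (1 + y\<^sup>2)\<^sup>2 = 1 - 2 / (1 + y\<^sup>2)\<^sup>2"
    using pos by (simp add: divide_simps) algebra
  then show "y * (y / (1 + y\<^sup>2)) - (1 - y\<^sup>2) / (1 + y\<^sup>2)\<^sup>2 \<le> 1" by simp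
qed real_asymp

lemma mills_antimono: "x \<le> y \<Longrightarrow> mills y \<le> mills x"
  using DERIV_mills mills_mult_le
  by (auto intro!: DERIV_nonpos_imp_nonincreasing[of x y mills] exI[of _ "_ * mills _ - 1"])

lemma convex_mills: "convex_on UNIV mills"
proof (rule f''_ge0_imp_convex)
  fix x
  show "(mills has_real_derivative x * mills x - 1) (at x)" by (rule DERIV_mills)
  show "((\<lambda>x. x * mills x - 1) has_real_derivative (1 + x\<^sup>2) * mills x - x) (at x)"
    by (auto intro!: derivative_eq_intros DERIV_mills simp: algebra_simps power2_eq_square)
  have "0 < 1 + x\<^sup>2" by (simp add: add_pos_nonneg)
  then show "0 \<le> (1 + x\<^sup>2) * mills x - x"
    using mills_ge_rational[of x] by (simp add: field_simps)
qed auto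

lemma mills_midpoint: "2 * mills x \<le> mills (x - s) + mills (x + s)"
proof -
  have "(1 - 1 / 2) *\<^sub>R (x - s) + (1 / 2) *\<^sub>R (x + s) = x" by (simp add: field_simps)
  then show ?thesis
    using convex_onD[OF convex_mills, of "1/2" "x - s" "x + s"] by simp
qed

text \<open>The lower bound \<open>num / den\<close> is the eighth convergent of Laplace's continued fraction
  \<open>1 / (y + 1 / (y + 2 / (y + 3 / \<dots>)))\<close> for the Mills ratio; the earlier ones are too weak here.\<close>

lemma mills_sqrt_7_5: "sqrt (7 / 5) / 2 < mills (sqrt (7 / 5))"
proof -
  define num den where "num y = y ^ 7 + 27 * y ^ 5 + 185 * y ^ 3 + 279 * y"
    and "den y = y ^ 8 + 28 * y ^ 6 + 210 * y ^ 4 + 420 * y\<^sup>2 + 105" for y :: real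
  define num' den' where "num' y = 7 * y ^ 6 + 135 * y ^ 4 + 555 * y\<^sup>2 + 279"
    and "den' y = 8 * y ^ 7 + 168 * y ^ 5 + 840 * y ^ 3 + 840 * y" for y :: real
  have pos: "0 < den y" for y
    unfolding den_def by (intro add_nonneg_pos add_nonneg_nonneg) auto
  have "num (sqrt (7 / 5)) / den (sqrt (7 / 5)) \<le> mills (sqrt (7 / 5))"
  proof (rule mills_ge[where r' = "\<lambda>y. (num' y * den y - num y * den' y) / (den y)\<^sup>2"])
    fix y :: real
    show "((\<lambda>y. num y / den y) has_real_derivative
        (num' y * den y - num y * den' y) / (den y)\<^sup>2) (at y)"
    proof -
      have "(num has_real_derivative num' y) (at y)"
        unfolding num_def num'_def by (auto intro!: derivative_eq_intros)
      moreover have "(den has_real_derivative den' y) (at y)"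
        unfolding den_def den'_def by (auto intro!: derivative_eq_intros)
      ultimately show ?thesis
        using pos[of y] by (auto intro!: derivative_eq_intros simp: power2_eq_square)
    qed
    \<comment> \<open>The residual of the convergent has the constant numerator 40320, which is 8
      factorial.\<close>
    have "(den y)\<^sup>2 - (y * num y * den y - num' y * den y + num y * den' y) = 40320"
      unfolding num_def den_def num'_def den'_def by (simp add: eval_nat_numeral algebra_simps)
    moreover have "y * (num y / den y) - (num' y * den y - num y * den' y) / (den y)\<^sup>2 =
        (y * num y * den y - num' y * den y + num y * den' y) / (den y)\<^sup>2"
      using pos[of y] by (simp add: field_simps power2_eq_square)
    ultimately show "y * (num y / den y) - (num' y * den y - num y * den' y) / (den y)\<^sup>2 \<le> 1"
      using pos[of y] by (simp add: divide_le_eq_1)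
  next
    show "((\<lambda>y. num y / den y) \<longlongrightarrow> 0) at_top"
      unfolding num_def den_def by real_asymp
  qed
  \<comment> \<open>As \<open>num\<close> is odd and \<open>den\<close> is even, both reduce to
    powers of \<open>s^2 = 7 / 5\<close>. The margin is small: \<open>num s / den s\<close> is about
    \<open>0.5009 * s\<close>.\<close>
  moreover have "sqrt (7 / 5) / 2 < num (sqrt (7 / 5)) / den (sqrt (7 / 5))"
  proof -
    define s where "s = sqrt (7 / 5)"
    have s2: "s\<^sup>2 = 7 / 5" and "0 < s" by (auto simp: s_def)
    have den: "den s = 740796 / 625"
    proof -
      have "den s = (s\<^sup>2) ^ 4 + 28 * (s\<^sup>2) ^ 3 + 210 * (s\<^sup>2)\<^sup>2 + 420 * s\<^sup>2 + 105"
        unfolding den_def by algebra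
      then show ?thesis by (simp add: s2 power_divide)
    qed
    have num: "num s = s * (74208 / 125)"
    proof -
      have "num s = s * ((s\<^sup>2) ^ 3 + 27 * (s\<^sup>2)\<^sup>2 + 185 * s\<^sup>2 + 279)"
        unfolding num_def by algebra
      then show ?thesis by (simp add: s2 power_divide)
    qed
    show ?thesis
      using \<open>0 < s\<close> unfolding s_def[symmetric] num den by (simp add: field_simps)
  qed
  ultimately show ?thesis by linarith
qed

subsection \<open>The symmetrised acceptance probability\<close>

text \<open>The expectation of \<open>exp (B / 2) * accept l B\<close> is twice that of \<open>Phi (B / l - l / 2)\<close>;
  the factor \<open>exp (B / 2)\<close> is split off to make \<open>accept l\<close> even.
  The derivative of \<open>accept\<close> in \<open>l\<close> is \<open>- accept_dens\<close>.\<close>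

definition accept :: "real \<Rightarrow> real \<Rightarrow> real" where
  "accept l x = exp (- x / 2) * Phi (x / l - l / 2) + exp (x / 2) * Phi (- x / l - l / 2)"

definition accept_dens :: "real \<Rightarrow> real \<Rightarrow> real" where
  "accept_dens l x = exp (- l\<^sup>2 / 8) * std_normal_density (x / l)"

lemma accept_minus: "accept l (- x) = accept l x"
  by (simp add: accept_def)

lemma accept_pos: "0 < accept l x"
  unfolding accept_def by (intro add_pos_pos mult_pos_pos Phi_pos) auto

lemma accept_dens_pos: "0 < accept_dens l x"
  by (simp add: accept_dens_def)

text \<open>Completing the square: the cross term of \<open>(x / l - l / 2)^2\<close> cancels the
  factor \<open>exp (- x / 2)\<close>. Both terms of \<open>accept\<close> thus carry the same
  Gaussian weight.\<close>

lemma exp_half_mult_density: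
  assumes "l \<noteq> 0"
  shows "exp (- x / 2) * std_normal_density (x / l - l / 2) = accept_dens l x"
    and "exp (x / 2) * std_normal_density (- x / l - l / 2) = accept_dens l x"
proof -
  have *: "exp (- x / 2) * std_normal_density (x / l - l / 2) = accept_dens l x" for x
  proof -
    have "- x / 2 - (x / l - l / 2)\<^sup>2 / 2 = - l\<^sup>2 / 8 - (x / l)\<^sup>2 / 2"
      using assms by (simp add: power2_diff) (simp add: power2_eq_square field_simps)
    then show ?thesis
      unfolding accept_dens_def std_normal_density_def
      by (simp add: exp_diff exp_minus field_simps flip: exp_add)
  qed
  show "exp (- x / 2) * std_normal_density (x / l - l / 2) = accept_dens l x" by (rule *)
  show "exp (x / 2) * std_normal_density (- x / l - l / 2) = accept_dens l x"
    using *[of "- x"] by (simp add: accept_dens_def)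
qed

lemma exp_half_mult_Phi:
  assumes "l \<noteq> 0"
  shows "exp (- x / 2) * Phi (x / l - l / 2) = accept_dens l x * mills (l / 2 - x / l)"
    and "exp (x / 2) * Phi (- x / l - l / 2) = accept_dens l x * mills (l / 2 + x / l)"
proof -
  have Phi: "Phi u = std_normal_density u * mills (- u)" for u
    by (simp add: mills_def)
  show "exp (- x / 2) * Phi (x / l - l / 2) = accept_dens l x * mills (l / 2 - x / l)"
    unfolding Phi[of "x / l - l / 2"] exp_half_mult_density(1)[OF assms, symmetric] by simp
  show "exp (x / 2) * Phi (- x / l - l / 2) = accept_dens l x * mills (l / 2 + x / l)"
    unfolding Phi[of "- x / l - l / 2"] exp_half_mult_density(2)[OF assms, symmetric]
    by (simp add: add.commute)
qed

lemma accept_eq_mills: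
  assumes "l \<noteq> 0"
  shows "accept l x = accept_dens l x * (mills (l / 2 - x / l) + mills (l / 2 + x / l))"
  unfolding accept_def exp_half_mult_Phi[OF assms] by (simp add: algebra_simps)

text \<open>Convexity of the Mills ratio makes the noiseless case \<open>x = 0\<close> extremal.\<close>

lemma accept_ge:
  assumes "l \<noteq> 0"
  shows "2 * mills (l / 2) * accept_dens l x \<le> accept l x"
  using mult_left_mono[OF mills_midpoint[of "l / 2" "x / l"], of "accept_dens l x"]
    accept_dens_pos[of l x]
  by (simp add: accept_eq_mills[OF assms] mult_ac)

text \<open>With equal Gaussian weights the inner derivatives \<open>- x / l^2 - 1 / 2\<close> and
  \<open>x / l^2 - 1 / 2\<close> add up to \<open>- 1\<close>.\<close>

lemma DERIV_accept:
  assumes "l \<noteq> 0"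
  shows "((\<lambda>l. accept l x) has_real_derivative - accept_dens l x) (at l)"
proof -
  have "((\<lambda>l. accept l x) has_real_derivative
      exp (- x / 2) * std_normal_density (x / l - l / 2) * (- x / l\<^sup>2 - 1 / 2) +
      exp (x / 2) * std_normal_density (- x / l - l / 2) * (x / l\<^sup>2 - 1 / 2)) (at l)"
    unfolding accept_def using assms
    by (auto intro!: derivative_eq_intros simp: power2_eq_square field_simps)
  then show ?thesis
    unfolding exp_half_mult_density[OF assms] by (simp add: algebra_simps)
qed

lemmas DERIV_accept_compose [derivative_intros] = DERIV_accept[THEN DERIV_chain2]

lemma accept_antimono:
  assumes "0 < a" "a \<le> b"
  shows "accept b x \<le> accept a x"
proof (rule DERIV_nonpos_imp_nonincreasing[OF assms(2)])
  fix l assume "a \<le> l"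
  with assms(1) have "((\<lambda>l. accept l x) has_real_derivative - accept_dens l x) (at l)"
    by (intro DERIV_accept) auto
  then show "\<exists>y. ((\<lambda>l. accept l x) has_real_derivative y) (at l) \<and> y \<le> 0"
    using accept_dens_pos[of l x] by force
qed

lemma DERIV_square_accept:
  assumes "l \<noteq> 0"
  shows "((\<lambda>l. l\<^sup>2 * accept l x) has_real_derivative
      2 * l * accept l x - l\<^sup>2 * accept_dens l x) (at l)"
  using assms by (auto intro!: derivative_eq_intros)

text \<open>By \<open>accept_ge\<close> the derivative is at least
  \<open>l * (4 * mills (l / 2) - l) * accept_dens l x\<close>. Its sign no longer depends on
  \<open>x\<close>.\<close>

lemma square_accept_strict_mono:
  assumes "0 < a" "a < b" and mills: "\<And>l. a < l \<Longrightarrow> l < b \<Longrightarrow> l < 4 * mills (l / 2)"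
  shows "a\<^sup>2 * accept a x < b\<^sup>2 * accept b x"
proof (rule DERIV_pos_imp_increasing_open[OF assms(2)])
  show "continuous_on {a..b} (\<lambda>l. l\<^sup>2 * accept l x)"
    using assms(1)
    by (intro continuous_at_imp_continuous_on ballI DERIV_isCont[OF DERIV_square_accept]) auto
  fix l assume l: "a < l" "l < b"
  then have "0 < l" using assms(1) by simp
  have "l * (l * accept_dens l x) < l * (4 * mills (l / 2) * accept_dens l x)"
    using mills[OF l] accept_dens_pos \<open>0 < l\<close> by (intro mult_strict_left_mono mult_strict_right_mono)
  also have "\<dots> \<le> l * (2 * accept l x)"
    using accept_ge[of l x] \<open>0 < l\<close> by (intro mult_left_mono) (auto simp: mult_ac)
  finally have "0 < 2 * l * accept l x - l\<^sup>2 * accept_dens l x"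
    by (simp add: power2_eq_square mult_ac)
  with DERIV_square_accept[of l x] \<open>0 < l\<close>
  show "\<exists>y. ((\<lambda>l. l\<^sup>2 * accept l x) has_real_derivative y) (at l) \<and> 0 < y" by force
qed

text \<open>The derivative is at least
  \<open>l^2 * (6 * mills (l / 2) - l) * accept_dens l x\<close>. The rational bound gives
  \<open>6 * mills (l / 2) >= 12 * l / (4 + l^2)\<close>, which is at least \<open>l\<close> exactly
  when \<open>l^2 <= 8\<close>.\<close>

lemma cube_accept_mono:
  assumes "0 < a" "a \<le> b" "b \<le> 2 * sqrt 2"
  shows "a ^ 3 * accept a x \<le> b ^ 3 * accept b x"
proof (rule DERIV_nonneg_imp_nondecreasing[OF assms(2)])
  fix l assume l: "a \<le> l" "l \<le> b"
  then have "0 < l" using assms(1) by simp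
  have "l\<^sup>2 \<le> (2 * sqrt 2)\<^sup>2"
    using l assms(3) \<open>0 < l\<close> by (intro power_mono) auto
  then have "l\<^sup>2 \<le> 8" by (simp add: power_mult_distrib)
  have "l \<le> 6 * ((l / 2) / (1 + (l / 2)\<^sup>2))"
    using \<open>l\<^sup>2 \<le> 8\<close> \<open>0 < l\<close>
    by (simp add: field_simps add_pos_nonneg power2_eq_square)
  also have "\<dots> \<le> 6 * mills (l / 2)"
    by (intro mult_left_mono mills_ge_rational) auto
  finally have "l * accept_dens l x \<le> 6 * mills (l / 2) * accept_dens l x"
    using accept_dens_pos[of l x] by (intro mult_right_mono) auto
  also have "\<dots> \<le> 3 * accept l x"
    using accept_ge[of l x] \<open>0 < l\<close> by (simp add: mult_ac)
  finally have "0 \<le> l\<^sup>2 * (3 * accept l x - l * accept_dens l x)" by simp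
  moreover have "((\<lambda>l. l ^ 3 * accept l x) has_real_derivative
      l\<^sup>2 * (3 * accept l x - l * accept_dens l x)) (at l)"
    using \<open>0 < l\<close>
    by (auto intro!: derivative_eq_intros simp: algebra_simps power2_eq_square power3_eq_cube)
  ultimately show "\<exists>y. ((\<lambda>l. l ^ 3 * accept l x) has_real_derivative y) (at l) \<and> 0 \<le> y" by blast
qed

section \<open>The noiseless optimum\<close>

lemma esjd_noiseless_eq: "esjd_noiseless l = l\<^sup>2 * accept l 0"
  by (simp add: esjd_noiseless_def accept_def)

text \<open>At \<open>x = 0\<close> the bound \<open>accept_ge\<close> is an equality, so a
  vanishing derivative pins down \<open>mills (l / 2)\<close>.\<close>

lemma noiseless_stationary:
  assumes "is_arg_max esjd_noiseless (\<lambda>l. 0 < l) l"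
  shows "0 < l" and "4 * mills (l / 2) = l"
proof -
  show "0 < l" using assms by (simp add: is_arg_max_def)
  have "2 * l * accept l 0 - l\<^sup>2 * accept_dens l 0 = 0"
  proof (rule DERIV_local_max[OF DERIV_square_accept])
    show "\<forall>y. \<bar>l - y\<bar> < l \<longrightarrow> y\<^sup>2 * accept y 0 \<le> l\<^sup>2 * accept l 0"
    proof (intro allI impI)
      fix y assume "\<bar>l - y\<bar> < l"
      then have "0 < y" by linarith
      then show "y\<^sup>2 * accept y 0 \<le> l\<^sup>2 * accept l 0"
        using assms unfolding is_arg_max_def esjd_noiseless_eq by (meson not_le)
    qed
  qed (use \<open>0 < l\<close> in auto)
  then have "l * accept_dens l 0 * (4 * mills (l / 2) - l) = 0"
    using \<open>0 < l\<close> by (simp add: accept_eq_mills power2_eq_square algebra_simps)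
  then show "4 * mills (l / 2) = l"
    using \<open>0 < l\<close> accept_dens_pos[of l 0] by simp
qed

text \<open>The bound is \<open>0.70 * (2 * sqrt 2)\<^sup>2\<close>.\<close>

lemma noiseless_square_gt:
  assumes "is_arg_max esjd_noiseless (\<lambda>l. 0 < l) l"
  shows "28 / 5 < l\<^sup>2"
proof (rule ccontr)
  note l = noiseless_stationary[OF assms]
  assume "\<not> 28 / 5 < l\<^sup>2"
  \<comment> \<open>With \<open>u = l / 2\<close>, stationarity reads
    \<open>2 * mills u = u\<close>. As \<open>mills\<close> decreases,
    \<open>u <= sqrt (7 / 5)\<close> would force
    \<open>2 * mills u > sqrt (7 / 5) >= u\<close>.\<close>
  then have "l / 2 \<le> sqrt (7 / 5)"
    by (intro real_le_rsqrt) (simp add: power_divide)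
  then have "mills (sqrt (7 / 5)) \<le> mills (l / 2)" by (rule mills_antimono)
  with \<open>l / 2 \<le> sqrt (7 / 5)\<close> mills_sqrt_7_5 l(2) show False by linarith
qed

section \<open>Integrated acceptance for scalings beyond 2 sqrt 2\<close>

text \<open>This is \<open>l\<^sup>2\<close> times the antiderivative of \<^term>\<open>accept l\<close>
  that comes from \<open>accept = 4 accept'' + (4 / l) accept_dens\<close>, where the primes are derivatives in \<open>x\<close>.\<close>

definition accept_prim :: "real \<Rightarrow> real \<Rightarrow> real" where
  "accept_prim l a = 2 * l\<^sup>2 * (exp (a / 2) * Phi (- a / l - l / 2) - exp (- a / 2) * Phi (a / l - l / 2))
    + 4 * l\<^sup>2 * exp (- l\<^sup>2 / 8) * (Phi (a / l) - Phi 0)"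

lemma accept_prim_0: "accept_prim l 0 = 0"
  by (simp add: accept_prim_def)

text \<open>The Gaussian term in \<open>accept_prim\<close> is chosen to cancel the densities that
  arise from differentiating the two values of \<open>Phi\<close>.\<close>

lemma DERIV_accept_prim:
  assumes "l \<noteq> 0"
  shows "(accept_prim l has_real_derivative l\<^sup>2 * accept l a) (at a)"
proof -
  have "(accept_prim l has_real_derivative
      2 * l\<^sup>2 * (exp (a / 2) * Phi (- a / l - l / 2) / 2 + exp (- a / 2) * Phi (a / l - l / 2) / 2
        - (exp (a / 2) * std_normal_density (- a / l - l / 2)) / l
        - (exp (- a / 2) * std_normal_density (a / l - l / 2)) / l)
      + 4 * l\<^sup>2 * accept_dens l a / l) (at a)"
    unfolding accept_prim_def accept_dens_def using assms
    by (auto intro!: derivative_eq_intros simp: field_simps)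
  moreover have "2 * l\<^sup>2 * (exp (a / 2) * Phi (- a / l - l / 2) / 2 + exp (- a / 2) * Phi (a / l - l / 2) / 2
      - accept_dens l a / l - accept_dens l a / l) + 4 * l\<^sup>2 * accept_dens l a / l = l\<^sup>2 * accept l a"
    using assms by (simp add: accept_def field_simps)
  ultimately show ?thesis
    unfolding exp_half_mult_density[OF assms] by simp
qed

text \<open>All density terms cancel again. The factor \<open>l^2 - 8\<close> comes from
  differentiating \<open>4 * l^2 * exp (- l^2 / 8)\<close>.\<close>

lemma DERIV_accept_prim_scale:
  assumes "l \<noteq> 0"
  shows "((\<lambda>l. accept_prim l a) has_real_derivative
      4 * l * (exp (a / 2) * Phi (- a / l - l / 2) - exp (- a / 2) * Phi (a / l - l / 2))
      - (l\<^sup>2 - 8) * l * exp (- l\<^sup>2 / 8) * (Phi (a / l) - Phi 0)) (at l)"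
proof -
  have "((\<lambda>l. accept_prim l a) has_real_derivative
      4 * l * (exp (a / 2) * Phi (- a / l - l / 2) - exp (- a / 2) * Phi (a / l - l / 2))
      + 2 * l\<^sup>2 * ((exp (a / 2) * std_normal_density (- a / l - l / 2)) * (a / l\<^sup>2 - 1 / 2)
        + (exp (- a / 2) * std_normal_density (a / l - l / 2)) * (a / l\<^sup>2 + 1 / 2))
      + (8 * l - l ^ 3) * exp (- l\<^sup>2 / 8) * (Phi (a / l) - Phi 0)
      - 4 * a * accept_dens l a) (at l)"
    unfolding accept_prim_def accept_dens_def using assms
    by (auto intro!: derivative_eq_intros)
       (simp add: field_simps power2_eq_square power3_eq_cube)
  moreover have "2 * l\<^sup>2 * (accept_dens l a * (a / l\<^sup>2 - 1 / 2) + accept_dens l a * (a / l\<^sup>2 + 1 / 2))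
      = 4 * a * accept_dens l a"
    using assms by (simp add: field_simps)
  ultimately show ?thesis
    unfolding exp_half_mult_density[OF assms]
    by (simp add: algebra_simps power2_eq_square power3_eq_cube)
qed

lemma exp_half_Phi_le:
  assumes "0 < l" "0 \<le> a"
  shows "exp (a / 2) * Phi (- a / l - l / 2) \<le> exp (- a / 2) * Phi (a / l - l / 2)"
proof -
  have "l \<noteq> 0" using assms by simp
  then show ?thesis
    unfolding exp_half_mult_Phi[OF \<open>l \<noteq> 0\<close>] using assms accept_dens_pos[of l a]
    by (intro mult_left_mono mills_antimono) auto
qed

text \<open>For \<open>l^2 >= 8\<close> both parts of the derivative in \<open>l\<close> are
  nonpositive. In the second, \<open>l^2 - 8\<close> and \<open>l\<close> are smallest at
  \<open>l1\<close>, the exponential and \<open>Phi\<close> at \<open>l2\<close>; this gives the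
  uniform slope bound \<open>- c\<close>.\<close>

lemma accept_prim_decrease:
  assumes "2 * sqrt 2 \<le> l1" "l1 \<le> l2" "0 \<le> a"
  shows "(l1\<^sup>2 - 8) * l1 * exp (- l2\<^sup>2 / 8) * (l2 - l1) * (Phi (a / l2) - Phi 0)
    \<le> accept_prim l1 a - accept_prim l2 a"
proof -
  define c where "c = (l1\<^sup>2 - 8) * l1 * exp (- l2\<^sup>2 / 8) * (Phi (a / l2) - Phi 0)"
  have "0 < l1" using assms(1) by (smt (verit) real_sqrt_gt_zero)
  have "(2 * sqrt 2)\<^sup>2 \<le> l1\<^sup>2" using assms(1) by (intro power_mono) auto
  then have "8 \<le> l1\<^sup>2" by (simp add: power_mult_distrib)
  have "accept_prim l2 a + c * l2 \<le> accept_prim l1 a + c * l1"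
  proof (rule DERIV_nonpos_imp_nonincreasing[OF assms(2)])
    fix l assume l: "l1 \<le> l" "l \<le> l2"
    then have "0 < l" using \<open>0 < l1\<close> by simp
    have "l1\<^sup>2 \<le> l\<^sup>2" "l\<^sup>2 \<le> l2\<^sup>2" using l \<open>0 < l1\<close> by (auto intro!: power_mono)
    then have "8 \<le> l\<^sup>2" using \<open>8 \<le> l1\<^sup>2\<close> by linarith
    have "Phi (a / l2) \<le> Phi (a / l)"
      using l \<open>0 < l\<close> assms(3) by (intro Phi_mono divide_left_mono) auto
    moreover have "Phi 0 \<le> Phi (a / l2)"
      using l \<open>0 < l\<close> assms(3) by (intro Phi_mono divide_nonneg_nonneg) auto
    ultimately have "c \<le> (l\<^sup>2 - 8) * l * exp (- l\<^sup>2 / 8) * (Phi (a / l) - Phi 0)"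
      unfolding c_def
      using l \<open>0 < l1\<close> \<open>0 < l\<close> \<open>8 \<le> l1\<^sup>2\<close> \<open>8 \<le> l\<^sup>2\<close>
      by (intro mult_mono mult_nonneg_nonneg) auto
    moreover have "4 * l * (exp (a / 2) * Phi (- a / l - l / 2)
        - exp (- a / 2) * Phi (a / l - l / 2)) \<le> 0"
      using exp_half_Phi_le[OF \<open>0 < l\<close> assms(3)] \<open>0 < l\<close> by (intro mult_nonneg_nonpos) auto
    moreover have "((\<lambda>l. accept_prim l a + c * l) has_real_derivative
        4 * l * (exp (a / 2) * Phi (- a / l - l / 2) - exp (- a / 2) * Phi (a / l - l / 2))
        - (l\<^sup>2 - 8) * l * exp (- l\<^sup>2 / 8) * (Phi (a / l) - Phi 0) + c) (at l)"
      using \<open>0 < l\<close> by (intro DERIV_add DERIV_accept_prim_scale DERIV_cmult_Id) auto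
    ultimately show "\<exists>y. ((\<lambda>l. accept_prim l a + c * l) has_real_derivative y) (at l) \<and> y \<le> 0"
      by force
  qed
  then show ?thesis by (simp add: c_def algebra_simps)
qed

text \<open>The Gaussian term is small enough to keep the integrals over \<open>{0..a}\<close> nonnegative;
  it makes the comparison of \<open>l1\<close> with \<open>l2\<close> strict.\<close>

definition accept_gap :: "real \<Rightarrow> real \<Rightarrow> real \<Rightarrow> real" where
  "accept_gap l1 l2 x = l1\<^sup>2 * accept l1 x - l2\<^sup>2 * accept l2 x
    - (l1\<^sup>2 - 8) * l1 * exp (- l2\<^sup>2 / 8) * (l2 - l1) * (std_normal_density (x / l2) / l2)"

lemma accept_gap_minus: "accept_gap l1 l2 (- x) = accept_gap l1 l2 x"
  by (simp add: accept_gap_def accept_minus)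

lemma continuous_accept_gap:
  assumes "0 < l1" "0 < l2"
  shows "continuous_on S (accept_gap l1 l2)"
proof -
  have Phi: "continuous_on S (\<lambda>x. Phi (f x))" if "continuous_on S f" for f :: "real \<Rightarrow> real"
    using that DERIV_isCont[OF DERIV_Phi] continuous_at_imp_continuous_on[of UNIV Phi]
    by (auto intro: continuous_on_compose2[of UNIV Phi])
  have dens: "continuous_on S (\<lambda>x. std_normal_density (f x))" if "continuous_on S f" for f :: "real \<Rightarrow> real"
    using that by (auto intro: continuous_on_compose2[OF continuous_on_std_normal_density])
  show ?thesis
    unfolding accept_gap_def accept_def using assms
    by (intro continuous_intros Phi dens) auto
qed

lemma integral_accept_gap_nonneg:
  assumes "2 * sqrt 2 \<le> l1" "l1 \<le> l2" "0 \<le> a"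
  shows "0 \<le> integral {0..a} (accept_gap l1 l2)"
proof -
  have pos: "0 < l1" "0 < l2" using assms by (smt (verit) real_sqrt_gt_zero)+
  define c where "c = (l1\<^sup>2 - 8) * l1 * exp (- l2\<^sup>2 / 8) * (l2 - l1)"
  define G where "G x = accept_prim l1 x - accept_prim l2 x - c * (Phi (x / l2) - Phi 0)" for x
  have "(G has_real_derivative accept_gap l1 l2 x) (at x)" for x
    unfolding G_def accept_gap_def c_def[symmetric] using pos
    by (intro DERIV_diff DERIV_accept_prim DERIV_cmult) (auto intro!: derivative_eq_intros)
  then have "(accept_gap l1 l2 has_integral (G a - G 0)) {0..a}"
    using assms(3)
    by (intro fundamental_theorem_of_calculus)
       (auto simp flip: has_real_derivative_iff_has_vector_derivative intro: has_field_derivative_at_within)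
  moreover have "G 0 = 0" by (simp add: G_def accept_prim_0)
  moreover have "0 \<le> G a"
    using accept_prim_decrease[OF assms] by (simp add: G_def c_def)
  ultimately show ?thesis by (simp add: integral_unique)
qed

subsection \<open>Even unimodal kernels and log-concavity\<close>

text \<open>The second mean value theorem, regrouped as in Abel summation, writes the integral as
  \<open>(k 0 - k N)\<close> times an integral of \<open>d\<close> over \<open>{0..c}\<close> plus
  \<open>k N\<close> times the one over \<open>{0..N}\<close>.\<close>

lemma integral_antimono_mult_nonneg:
  fixes k d :: "real \<Rightarrow> real"
  assumes d: "continuous_on UNIV d" "\<And>a. 0 \<le> a \<Longrightarrow> 0 \<le> integral {0..a} d"
    and k: "\<And>x. 0 \<le> k x" "\<And>x y. 0 \<le> x \<Longrightarrow> x \<le> y \<Longrightarrow> k y \<le> k x"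
    and "0 \<le> N"
  shows "0 \<le> integral {0..N} (\<lambda>x. k x * d x)"
proof -
  have int: "d integrable_on {a..b}" for a b
    using d(1) by (intro integrable_continuous_real) (auto intro: continuous_on_subset)
  obtain c where c: "c \<in> {0..N}" and eq: "integral {0..N} (\<lambda>x. - k x * d x) =
      - k 0 * integral {0..c} d + - k N * integral {c..N} d"
    using second_mean_value_theorem[OF int \<open>0 \<le> N\<close>, of "\<lambda>x. - k x"] k(2) by auto
  have split: "integral {0..N} d = integral {0..c} d + integral {c..N} d"
    using c int by (intro sym[OF Henstock_Kurzweil_Integration.integral_combine]) auto
  have "integral {0..N} (\<lambda>x. k x * d x) =
      (k 0 - k N) * integral {0..c} d + k N * integral {0..N} d"
    unfolding split using eq by (simp add: algebra_simps)
  moreover have "k N \<le> k 0" using k(2)[of 0 N] \<open>0 \<le> N\<close> by simp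
  ultimately show ?thesis
    using c d(2) k(1)[of N] \<open>0 \<le> N\<close> by (simp add: mult_nonneg_nonneg)
qed

text \<open>Evenness reduces \<open>{- n..n}\<close> to twice \<open>{0..n}\<close>, and dominated
  convergence lets \<open>n\<close> grow. A non-integrable product has integral 0 by
  convention.\<close>

lemma LBINT_even_unimodal_mult_nonneg:
  fixes k d :: "real \<Rightarrow> real"
  assumes d: "continuous_on UNIV d" "\<And>a. 0 \<le> a \<Longrightarrow> 0 \<le> integral {0..a} d"
    and k: "\<And>x. 0 \<le> k x" "\<And>x y. 0 \<le> x \<Longrightarrow> x \<le> y \<Longrightarrow> k y \<le> k x"
    and even: "\<And>x. d (- x) = d x" "\<And>x. k (- x) = k x"
  shows "0 \<le> (LBINT x. k x * d x)"
proof (cases "integrable lborel (\<lambda>x. k x * d x)")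
  case True
  let ?f = "\<lambda>x. k x * d x"
  have set_int: "set_integrable lborel {a..b} ?f" for a b
    unfolding set_integrable_def using True by (intro integrable_mult_indicator) auto
  have nonneg: "0 \<le> (LBINT x. indicator {- real n..real n} x * ?f x)" for n
  proof -
    have "(LBINT x. indicator {- real n..real n} x * ?f x) = integral {- real n..real n} ?f"
      using set_borel_integral_eq_integral(2)[OF set_int[of "- real n" "real n"]]
      by (simp add: set_lebesgue_integral_def)
    also have "\<dots> = integral {- real n..0} ?f + integral {0..real n} ?f"
      using set_borel_integral_eq_integral(1)[OF set_int]
      by (intro Henstock_Kurzweil_Integration.integral_combine[symmetric]) auto
    also have "integral {- real n..0} ?f = integral {0..real n} ?f"
      using Henstock_Kurzweil_Integration.integral_reflect_real[where a = 0 and b = "real n" and f = ?f] by (simp add: even)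
    finally show ?thesis
      using integral_antimono_mult_nonneg[OF d k, where N = "real n"] by simp
  qed
  have "(\<lambda>n. LBINT x. indicator {- real n..real n} x * ?f x) \<longlonglongrightarrow> (LBINT x. ?f x)"
  proof (rule integral_dominated_convergence[where w = "\<lambda>x. norm (?f x)"])
    show "AE x in lborel. (\<lambda>n. indicator {- real n..real n} x * ?f x) \<longlonglongrightarrow> ?f x"
    proof (rule AE_I2)
      fix x :: real
      obtain m where m: "\<bar>x\<bar> \<le> real m" using real_arch_simple by blast
      show "(\<lambda>n. indicator {- real n..real n} x * ?f x) \<longlonglongrightarrow> ?f x"
        by (rule tendsto_eventually, rule eventually_sequentiallyI[of m])
           (use m in \<open>auto simp: indicator_def\<close>)
    qed
  qed (use True in \<open>auto split: split_indicator\<close>)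
  then show ?thesis
    using nonneg by (intro LIMSEQ_le_const) auto
qed (simp add: not_integrable_integral_eq)

text \<open>The inner points are convex combinations of the outer ones with mirrored weights
  \<open>t\<close> and \<open>1 - t\<close>, so adding the two concavity inequalities removes
  \<open>t\<close>.\<close>

lemma log_concave_mult_antimono:
  assumes "log_concave g" and nonneg: "\<And>w. 0 \<le> g w" and "0 \<le> x" "x \<le> y"
  shows "g (v + y / 2) * g (v - y / 2) \<le> g (v + x / 2) * g (v - x / 2)"
proof (cases "g (v + y / 2) = 0 \<or> g (v - y / 2) = 0")
  case True
  then show ?thesis using nonneg by auto
next
  case False
  then have pos: "0 < g (v + y / 2)" "0 < g (v - y / 2)"
    using nonneg by (auto simp: less_le)
  show ?thesis
  proof (cases "y = 0")
    case True
    then show ?thesis using assms by simp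
  next
    case False
    then have "0 < y" using assms by simp
    let ?S = "{x. 0 < g x}"
    have conv: "convex ?S" and conc: "concave_on ?S (\<lambda>x. ln (g x))"
      using \<open>log_concave g\<close> by (auto simp: log_concave_def concave_on_def convex_on_def)
    define t where "t = 1 / 2 + x / (2 * y)"
    have t: "0 \<le> t" "t \<le> 1" using assms \<open>0 < y\<close> by (auto simp: t_def field_simps)
    have plus: "v + x / 2 = (1 - t) *\<^sub>R (v - y / 2) + t *\<^sub>R (v + y / 2)"
      and minus: "v - x / 2 = (1 - t) *\<^sub>R (v + y / 2) + t *\<^sub>R (v - y / 2)"
      using \<open>0 < y\<close> by (simp_all add: t_def field_simps)
    have gpos: "0 < g (v + x / 2)" "0 < g (v - x / 2)"
      using convexD_alt[OF conv, of "v - y / 2" "v + y / 2" t]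
        convexD_alt[OF conv, of "v + y / 2" "v - y / 2" t] pos t
      unfolding plus minus by auto
    have "(1 - t) * ln (g (v - y / 2)) + t * ln (g (v + y / 2)) \<le> ln (g (v + x / 2))"
      unfolding plus using concave_onD[OF conc t] pos by auto
    moreover have "(1 - t) * ln (g (v + y / 2)) + t * ln (g (v - y / 2)) \<le> ln (g (v - x / 2))"
      unfolding minus using concave_onD[OF conc t] pos by auto
    ultimately have "ln (g (v + y / 2)) + ln (g (v - y / 2)) \<le> ln (g (v + x / 2)) + ln (g (v - x / 2))"
      by (simp add: algebra_simps)
    then show ?thesis
      using pos gpos by (simp flip: ln_mult_pos)
  qed
qed

text \<open>The map from midpoint and difference to the two points has determinant -1. It is handled
  by translating \<open>v\<close> at fixed \<open>z\<close>, then \<open>z\<close> at fixed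
  \<open>v\<close>.\<close>

lemma distr_lborel_pair_midpoint:
  "distr (lborel \<Otimes>\<^sub>M lborel) (lborel \<Otimes>\<^sub>M lborel) (\<lambda>(v, z). (v + z / 2, v - z / 2)) =
    (lborel \<Otimes>\<^sub>M lborel :: (real \<times> real) measure)"
proof (rule measure_eqI)
  fix A :: "(real \<times> real) set"
  assume "A \<in> sets (distr (lborel \<Otimes>\<^sub>M lborel) (lborel \<Otimes>\<^sub>M lborel) (\<lambda>(v, z). (v + z / 2, v - z / 2)))"
  then have A [measurable]: "A \<in> sets (lborel \<Otimes>\<^sub>M lborel)" by simp
  let ?I = "indicator A :: real \<times> real \<Rightarrow> ennreal"
  have "emeasure (distr (lborel \<Otimes>\<^sub>M lborel) (lborel \<Otimes>\<^sub>M lborel) (\<lambda>(v, z). (v + z / 2, v - z / 2))) A =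
      (\<integral>\<^sup>+p. ?I p \<partial>distr (lborel \<Otimes>\<^sub>M lborel) (lborel \<Otimes>\<^sub>M lborel) (\<lambda>(v, z). (v + z / 2, v - z / 2)))"
    by (rule nn_integral_indicator[symmetric]) (simp only: sets_distr A)
  also have "\<dots> = (\<integral>\<^sup>+p. ?I (case p of (v, z) \<Rightarrow> (v + z / 2, v - z / 2)) \<partial>(lborel \<Otimes>\<^sub>M lborel))"
    by (rule nn_integral_distr) measurable
  also have "\<dots> = (\<integral>\<^sup>+z. \<integral>\<^sup>+v. ?I (v + z / 2, v - z / 2) \<partial>lborel \<partial>lborel)"
    by (subst lborel_pair.nn_integral_snd[symmetric]) simp_all
  also have "\<dots> = (\<integral>\<^sup>+z. \<integral>\<^sup>+v. ?I (v + z, v) \<partial>lborel \<partial>lborel)"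
  proof (rule nn_integral_cong)
    fix z :: real
    show "(\<integral>\<^sup>+v. ?I (v + z / 2, v - z / 2) \<partial>lborel) = (\<integral>\<^sup>+v. ?I (v + z, v) \<partial>lborel)"
      by (subst nn_integral_real_affine[of _ 1 "z / 2"]) (simp_all add: algebra_simps)
  qed
  also have "\<dots> = (\<integral>\<^sup>+v. \<integral>\<^sup>+z. ?I (v + z, v) \<partial>lborel \<partial>lborel)"
    by (rule lborel_pair.Fubini') simp
  also have "\<dots> = (\<integral>\<^sup>+v. \<integral>\<^sup>+z. ?I (z, v) \<partial>lborel \<partial>lborel)"
  proof (rule nn_integral_cong)
    fix v :: real
    show "(\<integral>\<^sup>+z. ?I (v + z, v) \<partial>lborel) = (\<integral>\<^sup>+z. ?I (z, v) \<partial>lborel)"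
      using nn_integral_real_affine[of "\<lambda>z. ?I (z, v)" 1 v] by simp
  qed
  also have "\<dots> = emeasure (lborel \<Otimes>\<^sub>M lborel) A"
    by (subst lborel_pair.nn_integral_snd) (simp, rule nn_integral_indicator[OF A])
  finally show "emeasure (distr (lborel \<Otimes>\<^sub>M lborel) (lborel \<Otimes>\<^sub>M lborel)
      (\<lambda>(v, z). (v + z / 2, v - z / 2))) A = emeasure (lborel \<Otimes>\<^sub>M lborel) A" .
qed simp

subsection \<open>The noise\<close>

locale pseudo_marginal_noise = prob_space M for M :: "'a measure" +
  fixes g :: "real \<Rightarrow> real" and Wstar W :: "'a \<Rightarrow> real"
  assumes g_nonneg: "0 \<le> g w"
    and distributed_Wstar: "distributed M lborel Wstar (\<lambda>w. ennreal (g w))"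
    and distributed_W: "distributed M lborel W (\<lambda>w. ennreal (exp w * g w))"
    and indep: "indep_var borel Wstar borel W"
begin

definition B :: "'a \<Rightarrow> real" where
  "B \<omega> = Wstar \<omega> - W \<omega>"

definition joint_dens :: "real \<times> real \<Rightarrow> real" where
  "joint_dens = (\<lambda>(x, y). g x * (exp y * g y))"

lemma g_measurable [measurable]: "g \<in> borel_measurable borel"
  using distributed_real_measurable[OF _ distributed_Wstar] g_nonneg by simp

lemma Wstar_measurable [measurable]: "Wstar \<in> borel_measurable M"
  using distributed_measurable[OF distributed_Wstar] by simp

lemma W_measurable [measurable]: "W \<in> borel_measurable M"
  using distributed_measurable[OF distributed_W] by simp

lemma B_measurable [measurable]: "B \<in> borel_measurable M"
  unfolding B_def by measurable

lemma joint_dens_nonneg: "0 \<le> joint_dens p"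
  by (auto simp: joint_dens_def g_nonneg split: prod.split)

lemma distributed_joint:
  "distributed M (lborel \<Otimes>\<^sub>M lborel) (\<lambda>\<omega>. (Wstar \<omega>, W \<omega>)) (\<lambda>p. ennreal (joint_dens p))"
proof -
  have "indep_var lborel Wstar lborel W"
    using indep by (simp add: indep_var_eq)
  then have "distributed M (lborel \<Otimes>\<^sub>M lborel) (\<lambda>\<omega>. (Wstar \<omega>, W \<omega>))
      (\<lambda>(x, y). ennreal (g x) * ennreal (exp y * g y))"
    using distributed_Wstar distributed_W
    by (intro distributed_joint_indep lborel.sigma_finite_measure_axioms)
  also have "(\<lambda>(x, y). ennreal (g x) * ennreal (exp y * g y)) = (\<lambda>p. ennreal (joint_dens p))"
    by (auto simp: joint_dens_def g_nonneg ennreal_mult intro!: ext)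
  finally show ?thesis .
qed

lemma
  fixes f :: "real \<Rightarrow> real"
  assumes [measurable]: "f \<in> borel_measurable borel"
  shows expectation_B: "expectation (\<lambda>\<omega>. f (B \<omega>)) =
      (LINT p|(lborel \<Otimes>\<^sub>M lborel). joint_dens p * f (fst p - snd p))"
    and integrable_B: "integrable M (\<lambda>\<omega>. f (B \<omega>)) \<longleftrightarrow>
      integrable (lborel \<Otimes>\<^sub>M lborel) (\<lambda>p. joint_dens p * f (fst p - snd p))"
  using distributed_integral[OF distributed_joint, of "\<lambda>p. f (fst p - snd p)"]
    distributed_integrable[OF distributed_joint, of "\<lambda>p. f (fst p - snd p)"]
  by (simp_all add: joint_dens_nonneg B_def)

text \<open>Swapping the two noise values multiplies their joint density by \<open>exp\<close> of their difference.\<close>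

lemma
  fixes f :: "real \<Rightarrow> real"
  assumes [measurable]: "f \<in> borel_measurable borel"
  shows expectation_B_reflect: "expectation (\<lambda>\<omega>. exp (B \<omega>) * f (- B \<omega>)) = expectation (\<lambda>\<omega>. f (B \<omega>))"
    and integrable_B_reflect: "integrable M (\<lambda>\<omega>. exp (B \<omega>) * f (- B \<omega>)) \<longleftrightarrow> integrable M (\<lambda>\<omega>. f (B \<omega>))"
proof -
  have meas [measurable]: "joint_dens \<in> borel_measurable (lborel \<Otimes>\<^sub>M lborel)"
    unfolding joint_dens_def by measurable
  have swap: "(\<lambda>(x, y). (\<lambda>p. joint_dens p * f (fst p - snd p)) (y, x)) =
      (\<lambda>p. joint_dens p * (exp (fst p - snd p) * f (- (fst p - snd p))))"
    by (auto simp: joint_dens_def exp_diff intro!: ext)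
  show "expectation (\<lambda>\<omega>. exp (B \<omega>) * f (- B \<omega>)) = expectation (\<lambda>\<omega>. f (B \<omega>))"
    using lborel_pair.integral_product_swap[of "\<lambda>p. joint_dens p * f (fst p - snd p)"]
      expectation_B[of f] expectation_B[of "\<lambda>x. exp x * f (- x)"]
    unfolding swap by simp
  show "integrable M (\<lambda>\<omega>. exp (B \<omega>) * f (- B \<omega>)) \<longleftrightarrow> integrable M (\<lambda>\<omega>. f (B \<omega>))"
    using lborel_pair.integrable_product_swap_iff[of "\<lambda>p. joint_dens p * f (fst p - snd p)"]
      integrable_B[of f] integrable_B[of "\<lambda>x. exp x * f (- x)"]
    unfolding swap by simp
qed

text \<open>\<open>exp (x / 2) * accept l x\<close> is a bounded term plus its reflection. By the
  swap identity the reflection is integrable although \<open>exp\<close> is unbounded, and has the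
  same expectation, which accounts for the factor 2 in \<open>esjd\<close>.\<close>

lemma
  assumes "l \<noteq> 0"
  shows integrable_accept: "integrable M (\<lambda>\<omega>. exp (B \<omega> / 2) * accept l (B \<omega>))"
    and esjd_eq: "esjd M B l = l\<^sup>2 * expectation (\<lambda>\<omega>. exp (B \<omega> / 2) * accept l (B \<omega>))"
proof -
  have [measurable]: "Phi \<in> borel_measurable borel"
    by (intro borel_measurable_mono monoI Phi_mono)
  have int1: "integrable M (\<lambda>\<omega>. Phi (B \<omega> / l - l / 2))"
    by (rule integrable_const_bound[of _ 1]) (auto simp: Phi_bounds)
  then have int2: "integrable M (\<lambda>\<omega>. exp (B \<omega>) * Phi (- B \<omega> / l - l / 2))"
    using integrable_B_reflect[of "\<lambda>x. Phi (x / l - l / 2)"] by simp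
  have eq: "exp (x / 2) * accept l x = Phi (x / l - l / 2) + exp x * Phi (- x / l - l / 2)" for x
    by (simp add: accept_def distrib_left mult.assoc[symmetric] flip: exp_add)
  show "integrable M (\<lambda>\<omega>. exp (B \<omega> / 2) * accept l (B \<omega>))"
    unfolding eq using int1 int2 by simp
  show "esjd M B l = l\<^sup>2 * expectation (\<lambda>\<omega>. exp (B \<omega> / 2) * accept l (B \<omega>))"
    unfolding eq esjd_def using int1 int2 expectation_B_reflect[of "\<lambda>x. Phi (x / l - l / 2)"] by simp
qed

text \<open>In midpoint \<open>v\<close> and difference \<open>z\<close>, the factor
  \<open>exp (z / 2)\<close> cancels the asymmetry of the joint density. At each fixed
  \<open>v\<close> an even unimodal kernel in \<open>z\<close> remains.\<close>

lemma expectation_even_nonneg: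
  fixes d :: "real \<Rightarrow> real"
  assumes "log_concave g" and d: "continuous_on UNIV d" "\<And>a. 0 \<le> a \<Longrightarrow> 0 \<le> integral {0..a} d"
    and even: "\<And>x. d (- x) = d x"
  shows "0 \<le> expectation (\<lambda>\<omega>. exp (B \<omega> / 2) * d (B \<omega>))"
proof (cases "integrable M (\<lambda>\<omega>. exp (B \<omega> / 2) * d (B \<omega>))")
  case True
  have [measurable]: "d \<in> borel_measurable borel"
    using d(1) by (rule borel_measurable_continuous_onI)
  define f where "f = (\<lambda>p. joint_dens p * (exp ((fst p - snd p) / 2) * d (fst p - snd p)))"
  define T where "T = (\<lambda>(v, z). (v + z / 2, v - z / 2 :: real))"
  have T [measurable]: "T \<in> (lborel \<Otimes>\<^sub>M lborel) \<rightarrow>\<^sub>M (lborel \<Otimes>\<^sub>M lborel)"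
    unfolding T_def by measurable
  have f [measurable]: "f \<in> borel_measurable (lborel \<Otimes>\<^sub>M lborel)"
    unfolding f_def joint_dens_def by measurable
  have distr: "distr (lborel \<Otimes>\<^sub>M lborel) (lborel \<Otimes>\<^sub>M lborel) T = lborel \<Otimes>\<^sub>M lborel"
    unfolding T_def by (rule distr_lborel_pair_midpoint)
  have fT: "f (T (v, z)) = exp v * (g (v + z / 2) * g (v - z / 2)) * d z" for v z
  proof -
    have "exp (v - z / 2) * exp (z / 2) = exp v" by (simp flip: exp_add)
    then show ?thesis by (simp add: f_def T_def joint_dens_def mult_ac)
  qed
  have "integrable (lborel \<Otimes>\<^sub>M lborel) f"
    using True integrable_B[of "\<lambda>x. exp (x / 2) * d x"] by (simp add: f_def)
  then have int: "integrable (lborel \<Otimes>\<^sub>M lborel) (\<lambda>p. f (T p))"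
    using integrable_distr_eq[OF T f] by (simp add: distr)
  have "expectation (\<lambda>\<omega>. exp (B \<omega> / 2) * d (B \<omega>)) = integral\<^sup>L (lborel \<Otimes>\<^sub>M lborel) f"
    using expectation_B[of "\<lambda>x. exp (x / 2) * d x"] by (simp add: f_def)
  also have "\<dots> = (LINT p|(lborel \<Otimes>\<^sub>M lborel). f (T p))"
    using integral_distr[OF T f] by (simp add: distr)
  also have "\<dots> = (LBINT v. LBINT z. f (T (v, z)))"
    using lborel_pair.integral_fst'[OF int] by simp
  also have "\<dots> \<ge> 0"
  proof (rule Bochner_Integration.integral_nonneg)
    fix v
    show "0 \<le> (LBINT z. f (T (v, z)))"
      unfolding fT using log_concave_mult_antimono[OF assms(1) g_nonneg]
      by (intro LBINT_even_unimodal_mult_nonneg d even) (auto simp: g_nonneg mult.commute)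
  qed
  finally show ?thesis .
qed (simp add: not_integrable_integral_eq)

section \<open>Monotonicity and ratio bounds for the noisy jumping distance\<close>

lemma expectation_accept_pos:
  assumes "l \<noteq> 0"
  shows "0 < expectation (\<lambda>\<omega>. exp (B \<omega> / 2) * accept l (B \<omega>))"
  using integral_less_AE_space[of "\<lambda>_. 0" "\<lambda>\<omega>. exp (B \<omega> / 2) * accept l (B \<omega>)"]
    integrable_accept[OF assms] emeasure_space_1
  by (simp add: accept_pos)

lemma esjd_strict_mono:
  assumes "0 < a" "a < b" and "\<And>l. a < l \<Longrightarrow> l < b \<Longrightarrow> l < 4 * mills (l / 2)"
  shows "esjd M B a < esjd M B b"
proof -
  have int: "integrable M (\<lambda>\<omega>. l\<^sup>2 * (exp (B \<omega> / 2) * accept l (B \<omega>)))" if "0 < l" for l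
    using integrable_accept[of l] that by simp
  have "expectation (\<lambda>\<omega>. a\<^sup>2 * (exp (B \<omega> / 2) * accept a (B \<omega>))) <
      expectation (\<lambda>\<omega>. b\<^sup>2 * (exp (B \<omega> / 2) * accept b (B \<omega>)))"
    using square_accept_strict_mono[OF assms] assms emeasure_space_1
    by (intro integral_less_AE_space int) (auto simp: mult.left_commute)
  then show ?thesis using assms by (simp add: esjd_eq)
qed

text \<open>Log-concavity yields only a weak inequality for \<open>accept_gap\<close>. Strictness
  comes from the positive expectation of the Gaussian term subtracted there.\<close>

lemma esjd_strict_antimono:
  assumes "log_concave g" "2 * sqrt 2 < l1" "l1 < l2"
  shows "esjd M B l2 < esjd M B l1"
proof -
  define c where "c = (l1\<^sup>2 - 8) * l1 * exp (- l2\<^sup>2 / 8) * (l2 - l1) / l2"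
  have pos: "0 < l1" "0 < l2" using assms by (smt (verit) real_sqrt_gt_zero)+
  have "(2 * sqrt 2)\<^sup>2 < l1\<^sup>2" using assms(2) by (intro power_strict_mono) auto
  then have "8 < l1\<^sup>2" by (simp add: power_mult_distrib)
  then have "0 < c" using pos assms(3) by (simp add: c_def)
  have dens_le: "exp (x / 2) * std_normal_density (x / l2) \<le> exp (l2\<^sup>2 / 8)" for x
  proof -
    have "exp (x / 2) * std_normal_density (x / l2) =
        exp (l2\<^sup>2 / 8) * std_normal_density (x / l2 - l2 / 2)"
      using exp_half_mult_density(1)[of l2 x] pos
      by (simp add: accept_dens_def exp_minus field_simps)
    also have "\<dots> \<le> exp (l2\<^sup>2 / 8)"
      using mult_left_mono[OF std_normal_density_le_1, of "exp (l2\<^sup>2 / 8)"] by simp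
    finally show ?thesis .
  qed
  have intN: "integrable M (\<lambda>\<omega>. exp (B \<omega> / 2) * std_normal_density (B \<omega> / l2))"
    by (rule integrable_const_bound[of _ "exp (l2\<^sup>2 / 8)"])
       (use dens_le in \<open>auto simp: abs_mult\<close>)
  have int: "integrable M (\<lambda>\<omega>. exp (B \<omega> / 2) * accept l1 (B \<omega>))"
    "integrable M (\<lambda>\<omega>. exp (B \<omega> / 2) * accept l2 (B \<omega>))"
    using integrable_accept pos by auto
  have gap: "accept_gap l1 l2 x =
      l1\<^sup>2 * accept l1 x - l2\<^sup>2 * accept l2 x - c * std_normal_density (x / l2)" for x
    by (simp add: accept_gap_def c_def)
  have "0 \<le> expectation (\<lambda>\<omega>. exp (B \<omega> / 2) * accept_gap l1 l2 (B \<omega>))"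
    using assms pos
    by (intro expectation_even_nonneg continuous_accept_gap integral_accept_gap_nonneg
        accept_gap_minus) auto
  also have "(\<lambda>\<omega>. exp (B \<omega> / 2) * accept_gap l1 l2 (B \<omega>)) =
      (\<lambda>\<omega>. l1\<^sup>2 * (exp (B \<omega> / 2) * accept l1 (B \<omega>)) - l2\<^sup>2 * (exp (B \<omega> / 2) * accept l2 (B \<omega>))
        - c * (exp (B \<omega> / 2) * std_normal_density (B \<omega> / l2)))"
    by (simp add: gap algebra_simps)
  finally have "c * expectation (\<lambda>\<omega>. exp (B \<omega> / 2) * std_normal_density (B \<omega> / l2))
      \<le> esjd M B l1 - esjd M B l2"
    using int intN pos by (simp add: esjd_eq)
  moreover have "0 < expectation (\<lambda>\<omega>. exp (B \<omega> / 2) * std_normal_density (B \<omega> / l2))"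
    using integral_less_AE_space[of "\<lambda>_. 0", OF _ intN] emeasure_space_1 by simp
  ultimately show ?thesis
    using \<open>0 < c\<close> by (smt (verit) mult_pos_pos)
qed

text \<open>If \<open>l1 <= l2\<close>, the decrease of \<open>accept\<close> bounds the ratio below
  by \<open>(l1 / l2)^2\<close>. Otherwise the increase of \<open>l^3 * accept l x\<close> bounds it
  below by \<open>l2 / l1\<close>, whose square exceeds 0.7.\<close>

lemma esjd_ratio:
  assumes "0 < a" "7 / 10 * 8 < a\<^sup>2" "a \<le> l1" "l1 \<le> 2 * sqrt 2" "a \<le> l2" "l2 \<le> 2 * sqrt 2"
  shows "7 / 10 * esjd M B l2 < esjd M B l1"
proof -
  define E where "E l = expectation (\<lambda>\<omega>. exp (B \<omega> / 2) * accept l (B \<omega>))" for l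
  have pos: "0 < l1" "0 < l2" using assms by auto
  have E: "0 < E l1" "0 < E l2" using pos by (auto simp: E_def expectation_accept_pos)
  have sq: "l\<^sup>2 \<le> 8" if "0 < l" "l \<le> 2 * sqrt 2" for l
    using power_mono[OF that(2), of 2] that(1) by (simp add: power_mult_distrib)
  have a_sq: "a\<^sup>2 \<le> l1\<^sup>2" "a\<^sup>2 \<le> l2\<^sup>2" using assms by (auto intro!: power_mono)
  show ?thesis
  proof (cases "l1 \<le> l2")
    case True
    have "7 / 10 * l2\<^sup>2 < l1\<^sup>2" using sq[of l2] assms pos a_sq by linarith
    then have "7 / 10 * l2\<^sup>2 * E l2 < l1\<^sup>2 * E l2" using E by simp
    also have "E l2 \<le> E l1"
      unfolding E_def using pos True
      by (intro integral_mono integrable_accept mult_left_mono accept_antimono) auto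
    finally show ?thesis using pos by (simp add: esjd_eq E_def)
  next
    case False
    then have "l2 ^ 3 * accept l2 x \<le> l1 ^ 3 * accept l1 x" for x
      using assms pos by (intro cube_accept_mono) auto
    then have "expectation (\<lambda>\<omega>. l2 ^ 3 * (exp (B \<omega> / 2) * accept l2 (B \<omega>)))
        \<le> expectation (\<lambda>\<omega>. l1 ^ 3 * (exp (B \<omega> / 2) * accept l1 (B \<omega>)))"
      using integrable_accept[of l1] integrable_accept[of l2] pos
      by (intro integral_mono) (auto simp: mult.left_commute)
    then have le: "l2 * (l2\<^sup>2 * E l2) \<le> l1 * (l1\<^sup>2 * E l1)"
      by (simp add: E_def power2_eq_square power3_eq_cube mult.assoc)
    have "49 / 100 * l1\<^sup>2 < l2\<^sup>2"
      using sq[of l1] assms pos a_sq by linarith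
    then have "(7 / 10 * l1)\<^sup>2 < l2\<^sup>2" by (simp add: power_mult_distrib power_divide)
    then have "7 / 10 * l1 < l2" by (rule power2_less_imp_less) (use pos in simp)
    then have "7 / 10 * l1 * (l2\<^sup>2 * E l2) < l2 * (l2\<^sup>2 * E l2)" using E pos by simp
    with le have "l1 * (7 / 10 * (l2\<^sup>2 * E l2)) < l1 * (l1\<^sup>2 * E l1)" by (simp add: mult_ac)
    then have "7 / 10 * (l2\<^sup>2 * E l2) < l1\<^sup>2 * E l1"
      using pos by (simp add: mult_less_cancel_left)
    then show ?thesis using pos by (simp add: esjd_eq E_def)
  qed
qed

end

theorem theorem1:
  fixes M :: "'a measure"
    and g :: "real \<Rightarrow> real"
    and Wstar W B :: "'a \<Rightarrow> real"
    and l_m l_inf :: real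
  assumes "prob_space M"
    and "\<And>w. 0 \<le> g w"
    and "distributed M lborel Wstar (\<lambda>w. ennreal (g w))"
    and "(LINT w|lborel. exp w * g w) = 1"
    and "distributed M lborel W (\<lambda>w. ennreal (exp w * g w))"
    and "prob_space.indep_var M borel Wstar borel W"
    and "B = (\<lambda>\<omega>. Wstar \<omega> - W \<omega>)"
    and "is_arg_max (esjd M B) (\<lambda>l. 0 < l) l_m"
    and "is_arg_max esjd_noiseless (\<lambda>l. 0 < l) l_inf"
  shows "l_inf \<le> l_m
    \<and> (log_concave g \<longrightarrow> l_m \<le> 2 * sqrt 2)
    \<and> (\<forall>l1\<in>{l_inf..2 * sqrt 2}. \<forall>l2\<in>{l_inf..2 * sqrt 2}.
          esjd M B l1 / esjd M B l2 > 0.70)"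
proof -
  interpret prob_space M by fact
  interpret noise: pseudo_marginal_noise M g Wstar W
    by unfold_locales fact+
  have B: "B = noise.B"
    using assms(7) by (simp add: noise.B_def fun_eq_iff)
  note l_inf = noiseless_stationary[OF assms(9)]
  have l_m: "0 < l_m" "\<And>l. 0 < l \<Longrightarrow> esjd M B l \<le> esjd M B l_m"
    using assms(8) unfolding is_arg_max_def by (blast, meson not_le)
  have "l_inf \<le> l_m"
  proof (rule ccontr)
    assume less: "\<not> l_inf \<le> l_m"
    \<comment> \<open>As \<open>mills\<close> decreases, \<open>4 * mills (l / 2)\<close> is at
      least its value \<open>l_inf\<close> at the noiseless optimum.\<close>
    have "l < 4 * mills (l / 2)" if "l < l_inf" for l
      using mills_antimono[of "l / 2" "l_inf / 2"] l_inf(2) that by simp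
    then have "esjd M B l_m < esjd M B l_inf"
      unfolding B using less l_m(1) by (intro noise.esjd_strict_mono) auto
    then show False using l_m(2)[OF l_inf(1)] by simp
  qed
  moreover have "l_m \<le> 2 * sqrt 2" if "log_concave g"
  proof (rule ccontr)
    assume "\<not> l_m \<le> 2 * sqrt 2"
    then obtain l where l: "2 * sqrt 2 < l" "l < l_m"
      using dense[of "2 * sqrt 2" l_m] by auto
    then have "esjd M B l_m < esjd M B l"
      unfolding B using that by (intro noise.esjd_strict_antimono)
    moreover have "0 < l" using l(1) by (smt (verit) real_sqrt_gt_zero)
    ultimately show False using l_m(2)[of l] by simp
  qed
  moreover have "0.70 < esjd M B l1 / esjd M B l2"
    if "l1 \<in> {l_inf..2 * sqrt 2}" "l2 \<in> {l_inf..2 * sqrt 2}" for l1 l2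
  proof -
    have "7 / 10 * esjd M B l2 < esjd M B l1"
      unfolding B using that l_inf(1) noiseless_square_gt[OF assms(9)]
      by (intro noise.esjd_ratio[of l_inf]) auto
    moreover have "0 < esjd M B l2"
      unfolding B using that l_inf(1) by (simp add: noise.esjd_eq noise.expectation_accept_pos)
    ultimately show ?thesis by (simp add: pos_less_divide_eq)
  qed
  ultimately show ?thesis by blast
qed

end
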